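(* Let $X$ be a completely regular space and let $\mathscr{H}$ be an ideal in $X$. Then the following are equivalent: (1) $X$ is connected modulo $\mathscr{H}$; (2) $\beta X\setminus\lambda_{\mathscr{H}}X$ is connected.
   Context: Completely regular means completely regular and Hausdorff (Tychonoff). $\beta X$ is the Stone--Čech compactification of $X$, with $X$ regarded as a dense subspace of $\beta X$. An ideal in a set $X$ is a non-empty collection of subsets of $X$ closed under taking subsets and under binary unions (it need not be proper, i.e. it may contain $X$). For an ideal $\mathscr{H}$ in a space $X$, a mapping $f:X\to[0,1]$ is $2$-valued modulo $\mathscr{H}$ if $f^{-1}(0)\notin\mathscr{H}$, $f^{-1}(1)\notin\mathscr{H}$ and $X\setminus(f^{-1}(0)\cup f^{-1}(1))\in\mathscr{H}$. The space $X$ is connected modulo $\mathscr{H}$ if there is no continuous mapping $f:X\to[0,1]$ which is $2$-valued modulo $\mathscr{H}$. A space is connected if there is no continuous mapping from it to $[0,1]$ which takes both values $0$ and $1$ and no other value; in particular the empty space counts as connected. Define $$\lambda_{\mathscr{H}}X=\bigcup\{\mathrm{int}_{\beta X}\mathrm{cl}_{\beta X}A: A\subseteq X,\ \mathrm{cl}_XA\in\mathscr{H}\}.$$ *)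

theory Defs
  imports "HOL-Analysis.Analysis"
begin

section \<open>The Stone--Cech compactification\<close>

text \<open>Functions are required to be extensional, so that each continuous map from the space to
  the unit interval is represented by exactly one HOL function.\<close>

definition unit_interval_maps :: "'a topology \<Rightarrow> ('a \<Rightarrow> real) set" where
  "unit_interval_maps X =
     {f \<in> extensional (topspace X). continuous_map X (top_of_set {0..1}) f}"

definition unit_cube :: "'a topology \<Rightarrow> (('a \<Rightarrow> real) \<Rightarrow> real) topology" where
  "unit_cube X = product_topology (\<lambda>_. top_of_set {0..1}) (unit_interval_maps X)"

definition stone_cech_embed :: "'a topology \<Rightarrow> 'a \<Rightarrow> (('a \<Rightarrow> real) \<Rightarrow> real)" where
  "stone_cech_embed X x = (\<lambda>f\<in>unit_interval_maps X. f x)"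

text \<open>The space \<open>\<beta>X\<close> is the closure, in the cube, of the image of \<open>X\<close> under the evaluation map.
  A subset \<open>A\<close> of \<open>X\<close>, regarded as a subset of \<open>\<beta>X\<close>, is \<open>stone_cech_embed X ` A\<close>.
  The lemmas below confirm the characteristic properties of \<open>\<beta>X\<close>, including the
  universal one.\<close>

definition stone_cech :: "'a topology \<Rightarrow> (('a \<Rightarrow> real) \<Rightarrow> real) topology" where
  "stone_cech X =
     subtopology (unit_cube X) (unit_cube X closure_of (stone_cech_embed X ` topspace X))"

lemma compact_space_unit_cube: "compact_space (unit_cube X)"
  unfolding unit_cube_def
  using compact_space_product_topology compact_space_subtopology compactin_euclidean_iff by blast

lemma Hausdorff_space_unit_cube: "Hausdorff_space (unit_cube X)"
  unfolding unit_cube_def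
  using Hausdorff_space_euclidean Hausdorff_space_product_topology Hausdorff_space_subtopology
  by blast

lemma compact_space_stone_cech: "compact_space (stone_cech X)"
  unfolding stone_cech_def
  by (intro compact_space_subtopology closedin_compact_space compact_space_unit_cube
      closedin_closure_of)

lemma Hausdorff_space_stone_cech: "Hausdorff_space (stone_cech X)"
  unfolding stone_cech_def by (simp add: Hausdorff_space_subtopology Hausdorff_space_unit_cube)

lemma continuous_map_stone_cech_embed_cube:
  "continuous_map X (unit_cube X) (stone_cech_embed X)"
  unfolding unit_cube_def continuous_map_componentwise
  by (auto simp: stone_cech_embed_def unit_interval_maps_def)

lemma stone_cech_embed_in_closure:
  "stone_cech_embed X ` topspace X \<subseteq> unit_cube X closure_of (stone_cech_embed X ` topspace X)"
  using continuous_map_stone_cech_embed_cube[of X]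
  by (meson closure_of_subset continuous_map_image_subset_topspace)

lemma topspace_stone_cech:
  "topspace (stone_cech X) = unit_cube X closure_of (stone_cech_embed X ` topspace X)"
  unfolding stone_cech_def by (simp add: closure_of_subset_topspace Int_absorb1)

lemma dense_stone_cech:
  "stone_cech X closure_of (stone_cech_embed X ` topspace X) = topspace (stone_cech X)"
  unfolding topspace_stone_cech unfolding stone_cech_def closure_of_subtopology
  using stone_cech_embed_in_closure[of X] by (simp add: Int_absorb1)

lemma embedding_map_stone_cech_embed:
  assumes "completely_regular_space X" "Hausdorff_space X"
  shows "embedding_map X (stone_cech X) (stone_cech_embed X)"
proof -
  have *: "mspace (submetric (cfunspace X euclidean_metric) {f. f \<in> topspace X \<rightarrow> {0..1::real}})
      = unit_interval_maps X"
  proof -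
    have "bounded (f ` topspace X)" if "f \<in> topspace X \<rightarrow> {0..1::real}" for f
      using that by (metis bounded_closed_interval bounded_subset image_subset_iff_funcset)
    then show ?thesis
      by (auto simp: unit_interval_maps_def continuous_map_in_subtopology image_subset_iff)
  qed
  have "embedding_map X (unit_cube X) (stone_cech_embed X)"
    using completely_regular_space_cube_embedding_explicit[OF assms]
    unfolding * unit_cube_def stone_cech_embed_def[abs_def] .
  then show ?thesis
    by (simp add: stone_cech_def embedding_map_in_subtopology stone_cech_embed_in_closure)
qed

lemma stone_cech_extension:
  fixes X :: "'a topology" and Y :: "'b topology"
  assumes Y: "compact_space Y" "Hausdorff_space Y" and f: "continuous_map X Y f"
  obtains g where "continuous_map (stone_cech X) Y g"
    "\<And>x. x \<in> topspace X \<Longrightarrow> g (stone_cech_embed X x) = f x"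
proof -
  let ?K = "unit_interval_maps Y"
  let ?pull = "\<lambda>h. restrict (h \<circ> f) (topspace X)"
  define F where "F p = (\<lambda>h\<in>?K. p (?pull h))" for p :: "('a \<Rightarrow> real) \<Rightarrow> real"
  have pull: "?pull h \<in> unit_interval_maps X" if "h \<in> ?K" for h
  proof -
    have "continuous_map X (top_of_set {0..1}) (h \<circ> f)"
      using that f continuous_map_compose by (auto simp: unit_interval_maps_def)
    then have "continuous_map X (top_of_set {0..1}) (?pull h)"
      by (rule continuous_map_eq) simp
    then show ?thesis
      by (simp add: unit_interval_maps_def)
  qed
  have F: "continuous_map (unit_cube X) (unit_cube Y) F"
    unfolding unit_cube_def continuous_map_componentwise
    using continuous_map_product_projection[OF pull]
    by (auto simp: F_def)
  have Fe: "F (stone_cech_embed X x) = stone_cech_embed Y (f x)" if "x \<in> topspace X" for x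
    using that pull by (auto simp: F_def stone_cech_embed_def)
  have "completely_regular_space Y"
    using Y compact_Hausdorff_or_regular_imp_normal_space normal_imp_completely_regular_space
    by blast
  then have emb: "embedding_map Y (unit_cube Y) (stone_cech_embed Y)"
    using embedding_map_stone_cech_embed[of Y] Y
    by (simp add: stone_cech_def embedding_map_in_subtopology)
  let ?I = "stone_cech_embed Y ` topspace Y"
  obtain r where r: "homeomorphic_maps Y (subtopology (unit_cube Y) ?I) (stone_cech_embed Y) r"
    using emb by (auto simp: embedding_map_def homeomorphic_map_maps)
  have "compactin (unit_cube Y) ?I"
    using Y continuous_map_stone_cech_embed_cube image_compactin compact_space_def by blast
  then have clo: "closedin (unit_cube Y) ?I"
    using Hausdorff_space_unit_cube compactin_imp_closedin by blast
  have "F ` topspace (stone_cech X) \<subseteq> unit_cube Y closure_of (F ` (stone_cech_embed X ` topspace X))"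
    unfolding topspace_stone_cech by (rule continuous_map_image_closure_subset[OF F])
  also have "\<dots> \<subseteq> ?I"
  proof (rule closure_of_minimal[OF _ clo])
    show "F ` stone_cech_embed X ` topspace X \<subseteq> ?I"
      using Fe f by (force simp: continuous_map_def)
  qed
  finally have "continuous_map (stone_cech X) (subtopology (unit_cube Y) ?I) F"
    using F by (auto simp: continuous_map_in_subtopology stone_cech_def
        continuous_map_from_subtopology image_subset_iff)
  then have "continuous_map (stone_cech X) Y (r \<circ> F)"
    using r by (meson continuous_map_compose homeomorphic_maps_def)
  moreover have "(r \<circ> F) (stone_cech_embed X x) = f x" if "x \<in> topspace X" for x
  proof -
    have "f x \<in> topspace Y"
      using that f by (auto simp: continuous_map_def)
    then show ?thesis
      using r that by (simp add: Fe homeomorphic_maps_def)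
  qed
  ultimately show ?thesis
    using that by blast
qed


section \<open>Connectedness modulo an ideal\<close>

definition set_ideal :: "'a set \<Rightarrow> 'a set set \<Rightarrow> bool" where
  "set_ideal S \<H> \<longleftrightarrow>
     \<H> \<noteq> {} \<and> \<H> \<subseteq> Pow S \<and>
     (\<forall>A B. A \<in> \<H> \<and> B \<subseteq> A \<longrightarrow> B \<in> \<H>) \<and>
     (\<forall>A B. A \<in> \<H> \<and> B \<in> \<H> \<longrightarrow> A \<union> B \<in> \<H>)"

definition two_valued_modulo :: "'a topology \<Rightarrow> 'a set set \<Rightarrow> ('a \<Rightarrow> real) \<Rightarrow> bool" where
  "two_valued_modulo X \<H> f \<longleftrightarrow>
     {x \<in> topspace X. f x = 0} \<notin> \<H> \<and>
     {x \<in> topspace X. f x = 1} \<notin> \<H> \<and>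
     topspace X - ({x \<in> topspace X. f x = 0} \<union> {x \<in> topspace X. f x = 1}) \<in> \<H>"

definition connected_modulo :: "'a topology \<Rightarrow> 'a set set \<Rightarrow> bool" where
  "connected_modulo X \<H> \<longleftrightarrow>
     \<not> (\<exists>f. continuous_map X (top_of_set {0..1}) f \<and> two_valued_modulo X \<H> f)"

definition lambda_ideal :: "'a topology \<Rightarrow> 'a set set \<Rightarrow> (('a \<Rightarrow> real) \<Rightarrow> real) set" where
  "lambda_ideal X \<H> =
     \<Union> {stone_cech X interior_of (stone_cech X closure_of (stone_cech_embed X ` A)) | A.
          A \<subseteq> topspace X \<and> X closure_of A \<in> \<H>}"

text \<open>The library's \<^const>\<open>connected_space\<close> (for which the empty space is connected) agrees with the
  definition by maps to the unit interval taking both values \<open>0\<close> and \<open>1\<close> and no other value.\<close>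

lemma connected_space_iff_no_01_map:
  "connected_space Y \<longleftrightarrow>
     \<not> (\<exists>f. continuous_map Y (top_of_set {0..1::real}) f \<and> f ` topspace Y = {0, 1})"
proof
  assume conn: "connected_space Y"
  show "\<not> (\<exists>f. continuous_map Y (top_of_set {0..1::real}) f \<and> f ` topspace Y = {0, 1})"
  proof
    assume "\<exists>f. continuous_map Y (top_of_set {0..1::real}) f \<and> f ` topspace Y = {0, 1}"
    then obtain f where f: "continuous_map Y (top_of_set {0..1::real}) f"
      and im: "f ` topspace Y = {0, 1}" by blast
    have "continuous_map Y euclideanreal f"
      using f by (simp add: continuous_map_in_subtopology)
    then have "connectedin euclideanreal (f ` topspace Y)"
      using conn connectedin_continuous_map_image connectedin_topspace by blast
    then have "connected {0, 1::real}"
      by (simp add: im)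
    then show False
      using connected_contains_Icc[of "{0,1::real}" 0 1]
      by (auto dest!: subsetD[where c = "1/2"])
  qed
next
  assume R: "\<not> (\<exists>f. continuous_map Y (top_of_set {0..1::real}) f \<and> f ` topspace Y = {0, 1})"
  show "connected_space Y"
  proof (rule ccontr)
    assume "\<not> connected_space Y"
    then obtain U V where UV: "openin Y U" "openin Y V" "U \<union> V = topspace Y" "U \<inter> V = {}"
      "U \<noteq> {}" "V \<noteq> {}"
      unfolding connected_space_eq by blast
    define f :: "'a \<Rightarrow> real" where "f x = (if x \<in> U then 0 else 1)" for x
    have "openin Y {x \<in> topspace Y. f x \<in> W}" for W
    proof -
      have "{x \<in> topspace Y. f x \<in> W} = (if 0 \<in> W then U else {}) \<union> (if 1 \<in> W then V else {})"
        using UV by (auto simp: f_def)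
      then show ?thesis
        using UV by auto
    qed
    then have "continuous_map Y (top_of_set {0..1}) f"
      by (auto simp: continuous_map_def f_def)
    moreover have "f ` topspace Y = {0, 1}"
      using UV by (auto simp: f_def image_def)
    ultimately show False
      using R by blast
  qed
qed

end

theory Submission
  imports Defs
begin

text \<open>Apart from being open, \<open>\<lambda>\<^sub>\<H>X\<close> enters only through two facts: it contains every open subset
  of \<open>\<beta>X\<close> whose trace on \<open>X\<close> lies in a closed member of \<open>\<H>\<close>, and every compact subset of it has
  its trace on \<open>X\<close> in \<open>\<H>\<close>. If \<open>f\<close> is 2-valued modulo \<open>\<H>\<close>, then by these facts its extension
  to \<open>\<beta>X\<close> takes exactly the values 0 and 1 on \<open>\<beta>X - \<lambda>\<^sub>\<H>X\<close>. Conversely, a separation of this closed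
  set is given by a map to \<open>{0, 1}\<close>, which extends to \<open>\<beta>X\<close> by Tietze's theorem; its restriction
  to \<open>X\<close>, suitably rescaled, is 2-valued modulo \<open>\<H>\<close>.\<close>

lemma set_ideal_finite_UN:
  assumes "set_ideal S \<H>" "finite I" "\<And>i. i \<in> I \<Longrightarrow> A i \<in> \<H>"
  shows "(\<Union>i\<in>I. A i) \<in> \<H>"
  using assms(2,3)
proof (induction I rule: finite_induct)
  case empty
  show ?case
    using assms(1) by (auto simp: set_ideal_def)
next
  case (insert i I)
  then show ?case
    using assms(1) by (simp add: set_ideal_def)
qed

lemma set_ideal_subset: "set_ideal S \<H> \<Longrightarrow> A \<in> \<H> \<Longrightarrow> B \<subseteq> A \<Longrightarrow> B \<in> \<H>"
  by (auto simp: set_ideal_def)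

lemma stone_cech_embed_in_topspace:
  "x \<in> topspace X \<Longrightarrow> stone_cech_embed X x \<in> topspace (stone_cech X)"
  using stone_cech_embed_in_closure[of X] by (auto simp: topspace_stone_cech)

lemma continuous_map_stone_cech_embed: "continuous_map X (stone_cech X) (stone_cech_embed X)"
  using continuous_map_stone_cech_embed_cube[of X] stone_cech_embed_in_closure[of X]
  by (auto simp: stone_cech_def continuous_map_in_subtopology)

text \<open>The evaluation map is a homeomorphism onto its image, so it carries closures in X to
  closures in the image, and the latter are traces of closures in \<beta>X. Injectivity then brings
  the point back to X. Complete regularity and the Hausdorff property enter the proof through this
  embedding.\<close>

lemma closure_of_stone_cech_embed_reflect:
  assumes "completely_regular_space X" "Hausdorff_space X"
    and A: "A \<subseteq> topspace X" and x: "x \<in> topspace X"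
    and cl: "stone_cech_embed X x \<in> stone_cech X closure_of (stone_cech_embed X ` A)"
  shows "x \<in> X closure_of A"
proof -
  let ?e = "stone_cech_embed X"
  let ?S = "subtopology (stone_cech X) (?e ` topspace X)"
  have hom: "homeomorphic_map X ?S ?e"
    using embedding_map_stone_cech_embed[OF assms(1,2)] by (simp add: embedding_map_def)
  have "?e ` topspace X \<inter> ?e ` A = ?e ` A"
    using A by blast
  then have "?e x \<in> ?S closure_of (?e ` A)"
    using cl x by (simp add: closure_of_subtopology)
  also have "\<dots> = ?e ` (X closure_of A)"
    using homeomorphic_map_closure_of[OF hom A] .
  finally show ?thesis
    using x homeomorphic_imp_injective_map[OF hom] closure_of_subset_topspace[of X A]
    by (auto dest: inj_onD)
qed

lemma openin_lambda_ideal: "openin (stone_cech X) (lambda_ideal X \<H>)"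
  by (auto simp: lambda_ideal_def)

text \<open>By density of X, the open set \<open>V\<close> lies in the closure of its own trace
  \<open>A\<close>, hence in the interior of that closure. The closed set \<open>D\<close> bounds
  the closure of \<open>A\<close> in X, which is what has to belong to \<H>.\<close>

lemma open_subset_lambda_ideal:
  assumes "set_ideal (topspace X) \<H>"
    and V: "openin (stone_cech X) V"
    and D: "closedin X D" "D \<in> \<H>"
    and sub: "{x \<in> topspace X. stone_cech_embed X x \<in> V} \<subseteq> D"
  shows "V \<subseteq> lambda_ideal X \<H>"
proof -
  let ?e = "stone_cech_embed X"
  define A where "A = {x \<in> topspace X. ?e x \<in> V}"
  have A: "A \<subseteq> topspace X" "V \<inter> ?e ` topspace X = ?e ` A"
    by (auto simp: A_def)
  have "X closure_of A \<subseteq> D"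
    using sub D by (simp add: A_def closure_of_minimal)
  then have "X closure_of A \<in> \<H>"
    using assms(1) D(2) set_ideal_subset by blast
  moreover have "V \<subseteq> stone_cech X closure_of (?e ` A)"
    using openin_Int_closure_of_subset[OF V, of "?e ` topspace X"] openin_subset[OF V]
    by (simp add: dense_stone_cech A(2) Int_absorb2)
  then have "V \<subseteq> stone_cech X interior_of (stone_cech X closure_of (?e ` A))"
    using V by (simp add: interior_of_maximal)
  ultimately show ?thesis
    using A(1) unfolding lambda_ideal_def by blast
qed

text \<open>A finite subfamily of the open sets that make up \<open>lambda_ideal X \<H>\<close>
  covers \<open>T\<close>. Each of them meets X only inside \<open>X closure_of A\<close>, a member
  of \<H>, and an ideal absorbs finite unions.\<close>

lemma compact_subset_lambda_ideal_trace:
  assumes "completely_regular_space X" "Hausdorff_space X"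
    and ideal: "set_ideal (topspace X) \<H>"
    and T: "compactin (stone_cech X) T" "T \<subseteq> lambda_ideal X \<H>"
  shows "{x \<in> topspace X. stone_cech_embed X x \<in> T} \<in> \<H>"
proof -
  let ?e = "stone_cech_embed X"
  let ?G = "\<lambda>A. stone_cech X interior_of (stone_cech X closure_of (?e ` A))"
  let ?\<A> = "{A. A \<subseteq> topspace X \<and> X closure_of A \<in> \<H>}"
  have cover: "T \<subseteq> \<Union> (?G ` ?\<A>)"
    using T(2) unfolding lambda_ideal_def by blast
  have "openin (stone_cech X) U" if "U \<in> ?G ` ?\<A>" for U
    using that by auto
  then obtain \<F> where \<F>: "finite \<F>" "\<F> \<subseteq> ?G ` ?\<A>" "T \<subseteq> \<Union> \<F>"
    using compactinD[OF T(1) _ cover] by meson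
  then obtain \<B> where \<B>: "\<B> \<subseteq> ?\<A>" "finite \<B>" "\<F> = ?G ` \<B>"
    by (meson finite_subset_image)
  have "x \<in> (\<Union>A\<in>\<B>. X closure_of A)" if x: "x \<in> topspace X" "?e x \<in> T" for x
  proof -
    obtain A where A: "A \<in> \<B>" "?e x \<in> ?G A"
      using x \<F>(3) \<B>(3) by blast
    then have "A \<subseteq> topspace X"
      using \<B>(1) by auto
    moreover have "?e x \<in> stone_cech X closure_of (?e ` A)"
      using A(2) interior_of_subset by (rule rev_subsetD)
    ultimately have "x \<in> X closure_of A"
      using closure_of_stone_cech_embed_reflect[OF assms(1,2) _ x(1)] by simp
    then show ?thesis
      using A(1) by (rule UN_I[rotated])
  qed
  then have "{x \<in> topspace X. ?e x \<in> T} \<subseteq> (\<Union>A\<in>\<B>. X closure_of A)"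
    by (intro subsetI) simp
  moreover have "(\<Union>A\<in>\<B>. X closure_of A) \<in> \<H>"
    using \<B>(1) by (intro set_ideal_finite_UN[OF ideal \<B>(2)]) auto
  ultimately show ?thesis
    using set_ideal_subset[OF ideal] by simp
qed

lemma closed_subset_lambda_ideal_trace:
  assumes "completely_regular_space X" "Hausdorff_space X"
    and "set_ideal (topspace X) \<H>"
    and "closedin (stone_cech X) T" "T \<subseteq> lambda_ideal X \<H>"
  shows "{x \<in> topspace X. stone_cech_embed X x \<in> T} \<in> \<H>"
  using assms closedin_compact_space compact_space_stone_cech compact_subset_lambda_ideal_trace
  by blast

lemma openin_preimage_real:
  assumes "continuous_map Y (top_of_set S) f" "open (W :: real set)"
  shows "openin Y {y \<in> topspace Y. f y \<in> W}"
  using assms openin_continuous_map_preimage[of Y euclideanreal f W]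
  by (simp add: continuous_map_in_subtopology)

lemma closedin_preimage_real:
  assumes "continuous_map Y (top_of_set S) f" "closed (W :: real set)"
  shows "closedin Y {y \<in> topspace Y. f y \<in> W}"
  using assms closedin_continuous_map_preimage[of Y euclideanreal f W]
  by (simp add: continuous_map_in_subtopology)

lemma two_valued_modulo_imp_disconnected:
  assumes X: "completely_regular_space X" "Hausdorff_space X"
    and ideal: "set_ideal (topspace X) \<H>"
    and f: "continuous_map X (top_of_set {0..1}) f" "two_valued_modulo X \<H> f"
  shows "\<not> connected_space
    (subtopology (stone_cech X) (topspace (stone_cech X) - lambda_ideal X \<H>))"
proof -
  let ?B = "stone_cech X" and ?e = "stone_cech_embed X"
  let ?K = "topspace ?B - lambda_ideal X \<H>"
  have "compact_space (top_of_set {0..1::real})" "Hausdorff_space (top_of_set {0..1::real})"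
    by (simp_all add: compact_space_subtopology Hausdorff_space_subtopology)
  then obtain F where F: "continuous_map ?B (top_of_set {0..1}) F"
    and Fe: "\<And>x. x \<in> topspace X \<Longrightarrow> F (?e x) = f x"
    using stone_cech_extension[OF _ _ f(1)] by metis
  have F01: "F p \<in> {0..1}" if "p \<in> topspace ?B" for p
    using F that by (auto simp: continuous_map_def)
  have mid: "p \<in> lambda_ideal X \<H>" if p: "p \<in> topspace ?B" "0 < F p" "F p < 1" for p
  proof -
    \<comment> \<open>These are the midpoints between \<open>F p\<close> and the values 0 and 1. The
      closed band between them avoids 0 and 1, so it yields a closed member \<open>?D\<close> of
      \<H>, whereas the set where \<open>f\<close> lies strictly between 0 and 1 need not be
      closed.\<close>
    let ?a = "F p / 2" and ?b = "(F p + 1) / 2"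
    let ?V = "{q \<in> topspace ?B. F q \<in> {?a<..<?b}}" and ?D = "{x \<in> topspace X. f x \<in> {?a..?b}}"
    have "?D \<subseteq> topspace X - ({x \<in> topspace X. f x = 0} \<union> {x \<in> topspace X. f x = 1})"
      using p by auto
    then have "?D \<in> \<H>"
      using f(2) set_ideal_subset[OF ideal] unfolding two_valued_modulo_def by blast
    moreover have "{x \<in> topspace X. ?e x \<in> ?V} \<subseteq> ?D"
      using Fe by auto
    ultimately have "?V \<subseteq> lambda_ideal X \<H>"
      by (intro open_subset_lambda_ideal[OF ideal, of ?V ?D] openin_preimage_real[OF F]
          closedin_preimage_real[OF f(1)] open_greaterThanLessThan closed_atLeastAtMost)
    then show ?thesis
      using p by auto
  qed
  have attained: "\<exists>p\<in>?K. F p = c" if c: "{x \<in> topspace X. f x = c} \<notin> \<H>" for c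
  proof (rule ccontr)
    \<comment> \<open>If the fibre of \<open>F\<close> over \<open>c\<close> missed
      \<open>?K\<close>, it would be a closed subset of \<open>lambda_ideal X \<H>\<close>, and its
      trace, the level set of \<open>f\<close> at \<open>c\<close>, would be in \<H>.\<close>
    let ?T = "{p \<in> topspace ?B. F p \<in> {c}}"
    assume "\<not> (\<exists>p\<in>?K. F p = c)"
    then have "?T \<subseteq> lambda_ideal X \<H>"
      by auto
    then have "{x \<in> topspace X. ?e x \<in> ?T} \<in> \<H>"
      by (intro closed_subset_lambda_ideal_trace[OF X ideal] closedin_preimage_real[OF F]) simp
    moreover have "{x \<in> topspace X. ?e x \<in> ?T} = {x \<in> topspace X. f x = c}"
      using Fe stone_cech_embed_in_topspace by fastforce
    ultimately show False
      using c by simp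
  qed
  have "F ` ?K \<subseteq> {0, 1}"
    using mid F01 by (force simp: less_le)
  moreover have "{0, 1} \<subseteq> F ` ?K"
    using attained f(2) unfolding two_valued_modulo_def by (auto simp: image_iff)
  ultimately have "F ` ?K = {0, 1}"
    by blast
  moreover have "topspace (subtopology ?B ?K) = ?K"
    by auto
  ultimately show ?thesis
    using continuous_map_from_subtopology[OF F] connected_space_iff_no_01_map by metis
qed

lemma disconnected_imp_two_valued_modulo:
  assumes X: "completely_regular_space X" "Hausdorff_space X"
    and ideal: "set_ideal (topspace X) \<H>"
    and disc: "\<not> connected_space
      (subtopology (stone_cech X) (topspace (stone_cech X) - lambda_ideal X \<H>))"
  obtains f where "continuous_map X (top_of_set {0..1}) f" "two_valued_modulo X \<H> f"
proof -
  let ?B = "stone_cech X" and ?e = "stone_cech_embed X"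
  let ?K = "topspace ?B - lambda_ideal X \<H>"
  have "topspace (subtopology ?B ?K) = ?K"
    by auto
  then obtain g where g: "continuous_map (subtopology ?B ?K) (top_of_set {0..1}) g"
    and gK: "g ` ?K = {0, 1::real}"
    using disc connected_space_iff_no_01_map by metis
  have "normal_space ?B"
    by (simp add: compact_Hausdorff_or_regular_imp_normal_space compact_space_stone_cech
        Hausdorff_space_stone_cech)
  moreover have "closedin ?B ?K"
    by (simp add: openin_lambda_ideal closedin_diff)
  moreover have "continuous_map (subtopology ?B ?K) euclideanreal g"
    using g by (simp add: continuous_map_in_subtopology)
  ultimately obtain F where F: "continuous_map ?B euclideanreal F"
    and FK: "\<And>p. p \<in> ?K \<Longrightarrow> F p = g p"
    using Tietze_extension_realinterval[of ?B ?K UNIV g]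
    by (metis UNIV_not_empty is_interval_univ subset_UNIV)
  \<comment> \<open>Rescaling makes the level sets of \<open>f\<close> at 0 and 1 traces of neighbourhoods of those of \<open>F\<close>.\<close>
  define f where "f x = max 0 (min 1 (3 * F (?e x) - 1))" for x
  have Fe: "continuous_map X euclideanreal (F \<circ> ?e)"
    using F continuous_map_stone_cech_embed continuous_map_compose by blast
  have "continuous_map X euclideanreal f"
    unfolding f_def using Fe
    by (intro continuous_intros) (simp_all add: o_def)
  then have f: "continuous_map X (top_of_set {0..1}) f"
    by (auto simp: continuous_map_in_subtopology f_def)
  \<comment> \<open>Were the level set in \<H>, the open set where \<open>F\<close> takes values in
    \<open>W\<close> would lie in \<open>lambda_ideal X \<H>\<close>. But it contains a point of
    \<open>?K\<close> at which \<open>g\<close> has the value \<open>c\<close>.\<close>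
  have level: "{x \<in> topspace X. f x = c} \<notin> \<H>"
    if c: "c \<in> {0, 1}" "open W" "c \<in> W" "\<And>x. F (?e x) \<in> W \<Longrightarrow> f x = c" for c W
  proof
    assume "{x \<in> topspace X. f x = c} \<in> \<H>"
    moreover have "closedin X {x \<in> topspace X. f x = c}"
      using closedin_preimage_real[OF f, of "{c}"] by simp
    moreover have "openin ?B {p \<in> topspace ?B. F p \<in> W}"
      using F c(2) by (simp add: openin_continuous_map_preimage)
    ultimately have "{p \<in> topspace ?B. F p \<in> W} \<subseteq> lambda_ideal X \<H>"
      using c(4) open_subset_lambda_ideal[OF ideal] by blast
    moreover obtain p where "p \<in> ?K" "g p = c"
      using c(1) gK by (metis imageE)
    ultimately show False
      using c(3) FK[of p] by auto
  qed
  have "{x \<in> topspace X. f x = 0} \<notin> \<H>"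
    by (rule level[of 0 "{..<1/3}"]) (auto simp: f_def)
  moreover have "{x \<in> topspace X. f x = 1} \<notin> \<H>"
    by (rule level[of 1 "{2/3<..}"]) (auto simp: f_def)
  moreover have "topspace X - ({x \<in> topspace X. f x = 0} \<union> {x \<in> topspace X. f x = 1}) \<in> \<H>"
  proof -
    \<comment> \<open>Wherever \<open>f\<close> is neither 0 nor 1, \<open>F\<close> lies strictly
      between 1/3 and 2/3 at the image point. This closed band misses \<open>?K\<close>, where
      \<open>F\<close> is 0 or 1.\<close>
    let ?T = "{p \<in> topspace ?B. F p \<in> {1/3..2/3}}"
    have "F p \<in> {0, 1}" if "p \<in> ?K" for p
      using that FK gK by (metis imageI)
    then have "?T \<subseteq> lambda_ideal X \<H>"
      by fastforce
    then have "{x \<in> topspace X. ?e x \<in> ?T} \<in> \<H>"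
      using F
      by (intro closed_subset_lambda_ideal_trace[OF X ideal] closedin_continuous_map_preimage) auto
    then show ?thesis
      by (rule set_ideal_subset[OF ideal])
        (auto simp: f_def stone_cech_embed_in_topspace max_def min_def split: if_splits)
  qed
  ultimately show ?thesis
    using that f unfolding two_valued_modulo_def by blast
qed

theorem theorem2p18:
  fixes X :: "'a topology" and \<H> :: "'a set set"
  assumes "completely_regular_space X" and "Hausdorff_space X"
    and "set_ideal (topspace X) \<H>"
  shows "connected_modulo X \<H> \<longleftrightarrow>
    connected_space (subtopology (stone_cech X) (topspace (stone_cech X) - lambda_ideal X \<H>))"
  using two_valued_modulo_imp_disconnected[OF assms] disconnected_imp_two_valued_modulo[OF assms]
  unfolding connected_modulo_def by metis

end
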